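(* Let $D_0$ be a northeast diagram. Then the Kohnert polynomial $\mathfrak{K}_{D_0}$ is monomial multiplicity-free (all its coefficients in the monomial basis are $0$ or $1$) if and only if $D_0$ does not contain cells $x_1=(r_1,c_1)$ and $x_2=(r_2,c_2)$ such that: (a) $r_1<r_2$; (b) $c_1<c_2$; (c) there is at least one empty position $(r,c_1)$ (i.e. $(r,c_1)\notin D_0$) with $r<r_1$; and (d) for each column index $c>c_1$, there are at least two empty positions $(r,c)$ with $r\le r_1$.
   Context: A diagram is a finite subset of $\mathbb{N}\times\mathbb{N}$ ($\mathbb{N}=\{1,2,\dots\}$); an element $(r,c)$ is a cell in row $r$ and column $c$, rows numbered bottom to top; a position is empty if not in the diagram. A Kohnert move on $D$ selects a row, takes the rightmost cell $(r,c)$ of $D$ in that row, and moves it to $(r',c)$ where $r'$ is the largest $1\le r'<r$ with $(r',c)\notin D$ (no move if none exists). $\mathcal{P}(D)$ is the set of diagrams obtainable from $D$ by finitely many Kohnert moves (including $D$). The row weight $\mathrm{rwt}(T)$ of a diagram $T$ has $i$-th entry the number of cells of $T$ in row $i$. The Kohnert polynomial is $\mathfrak{K}_D=\sum_{T\in\mathcal{P}(D)}\prod_i x_i^{\mathrm{rwt}(T)_i}$. A diagram $D$ is northeast if for all cells $(r_1,c_1),(r_2,c_2)\in D$, $(\max(r_1,r_2),\max(c_1,c_2))\in D$. *)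

theory Defs
  imports Main "HOL-Library.Poly_Mapping"
begin

text \<open>A cell is a pair (row, column), both counted from 1; rows are numbered bottom to top.\<close>

type_synonym cell = "nat \<times> nat"

definition positions :: "cell set" where
  "positions = {1..} \<times> {1..}"

definition diagram :: "cell set \<Rightarrow> bool" where
  "diagram D \<longleftrightarrow> finite D \<and> D \<subseteq> positions"

definition empty_position :: "cell set \<Rightarrow> cell \<Rightarrow> bool" where
  "empty_position D p \<longleftrightarrow> p \<in> positions \<and> p \<notin> D"

definition northeast :: "cell set \<Rightarrow> bool" where
  "northeast D \<longleftrightarrow>
     (\<forall>r1 c1 r2 c2. (r1, c1) \<in> D \<longrightarrow> (r2, c2) \<in> D \<longrightarrow> (max r1 r2, max c1 c2) \<in> D)"

definition rightmost_in_row :: "cell set \<Rightarrow> nat \<Rightarrow> nat \<Rightarrow> bool" where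
  "rightmost_in_row D r c \<longleftrightarrow> (r, c) \<in> D \<and> (\<forall>c'. (r, c') \<in> D \<longrightarrow> c' \<le> c)"

definition kohnert_move :: "cell set \<Rightarrow> cell set \<Rightarrow> bool" where
  "kohnert_move D D' \<longleftrightarrow>
     (\<exists>r c r'. rightmost_in_row D r c \<and>
        r' < r \<and> empty_position D (r', c) \<and>
        (\<forall>s<r. empty_position D (s, c) \<longrightarrow> s \<le> r') \<and>
        D' = insert (r', c) (D - {(r, c)}))"

definition kohnert_diagrams :: "cell set \<Rightarrow> cell set set" where
  "kohnert_diagrams D = {T. kohnert_move\<^sup>*\<^sup>* D T}"

definition rwt :: "cell set \<Rightarrow> nat \<Rightarrow> nat" where
  "rwt T i = card {c. (i, c) \<in> T}"

text \<open>
  Integer polynomials in the variables \<open>x\<^sub>1, x\<^sub>2, \<dots>\<close> are finitely supported maps from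
  exponent vectors (themselves finitely supported) to coefficients.
\<close>

type_synonym mpoly_int = "(nat \<Rightarrow>\<^sub>0 nat) \<Rightarrow>\<^sub>0 int"

definition var :: "nat \<Rightarrow> mpoly_int" where
  "var i = Poly_Mapping.single (Poly_Mapping.single i 1) 1"

text \<open>The product ranges over the nonempty rows; every other row contributes the factor 1.\<close>

definition row_monomial :: "cell set \<Rightarrow> mpoly_int" where
  "row_monomial T = (\<Prod>i \<in> fst ` T. var i ^ rwt T i)"

text \<open>The sum is a genuine finite sum for every diagram, by \<open>finite_kohnert_diagrams\<close> below.\<close>

definition kohnert_polynomial :: "cell set \<Rightarrow> mpoly_int" where
  "kohnert_polynomial D = (\<Sum>T \<in> kohnert_diagrams D. row_monomial T)"

definition monomial_multiplicity_free :: "mpoly_int \<Rightarrow> bool" where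
  "monomial_multiplicity_free p \<longleftrightarrow> (\<forall>m. Poly_Mapping.lookup p m \<in> {0, 1})"

lemma kohnert_move_subset:
  assumes "kohnert_move D D'" "D \<subseteq> {..R} \<times> C"
  shows "D' \<subseteq> {..R} \<times> C"
  using assms unfolding kohnert_move_def rightmost_in_row_def by fastforce

lemma kohnert_diagrams_subset:
  assumes "T \<in> kohnert_diagrams D" "D \<subseteq> {..R} \<times> C"
  shows "T \<subseteq> {..R} \<times> C"
proof -
  have "kohnert_move\<^sup>*\<^sup>* D T" using assms(1) by (simp add: kohnert_diagrams_def)
  then show ?thesis using assms(2)
    by induction (auto dest: kohnert_move_subset)
qed

lemma finite_kohnert_diagrams:
  assumes "diagram D"
  shows "finite (kohnert_diagrams D)"
proof -
  have fin: "finite D" using assms by (simp add: diagram_def)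
  have "D \<subseteq> {..Max (fst ` D)} \<times> snd ` D"
  proof
    fix x assume "x \<in> D"
    then show "x \<in> {..Max (fst ` D)} \<times> snd ` D"
      using fin by (cases x) (auto intro!: Max_ge rev_image_eqI)
  qed
  then have "kohnert_diagrams D \<subseteq> Pow ({..Max (fst ` D)} \<times> snd ` D)"
    using kohnert_diagrams_subset by blast
  moreover have "finite (Pow ({..Max (fst ` D)} \<times> snd ` D))"
    using fin by simp
  ultimately show ?thesis by (rule finite_subset)
qed

lemma diagram_kohnert_move:
  assumes "kohnert_move D D'" "diagram D"
  shows "diagram D'"
  using assms unfolding kohnert_move_def diagram_def empty_position_def by auto

end

theory Submission
  imports Defs
begin

text \<open>
  Multiplicity-freeness says that distinct Kohnert diagrams have distinct row weights. Let
  \<open>(R, M)\<close> be the corner of \<open>D\<close>: its top row and last column, a cell of \<open>D\<close> by the northeast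
  condition.

  If the pattern occurs in column \<open>c\<^sub>1\<close>, take its lowest occurrence \<open>(r, c\<^sub>1)\<close>; then \<open>(r - 1, c\<^sub>1)\<close> is
  empty. Clear row \<open>r\<close> to the right of \<open>c\<^sub>1\<close>, as well as \<open>(r - 1, M)\<close>. Now one may either lower
  \<open>(r, c\<^sub>1)\<close> to row \<open>r - 1\<close> and bring the next cell of column \<open>M\<close> down to row \<open>r\<close>, or bring that
  cell down to row \<open>r - 1\<close>: two diagrams of equal weight.

  If it does not occur, let \<open>k < R\<close> be the last row below the top one with a cell left of
  column \<open>M\<close>. In the rows up to \<open>k\<close>, either some column \<open>b\<close> is full and no cell lies strictly between
  the columns \<open>b\<close> and \<open>M\<close>, or column \<open>M\<close> has exactly one hole. In both cases an invariant of
  Kohnert moves shows that, given the rows above \<open>r\<close>, the possible contents of row \<open>r\<close> form a chain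
  under inclusion, so the weight determines the diagram row by row from the top.
\<close>

section \<open>Multiplicity-freeness as injectivity of the row weight\<close>

lemma var_power: "var i ^ n = Poly_Mapping.single (Poly_Mapping.single i n) 1"
proof (induction n)
  case (Suc n)
  have "var i ^ Suc n = Poly_Mapping.single (Poly_Mapping.single i 1) 1 * Poly_Mapping.single (Poly_Mapping.single i n) 1"
    unfolding power_Suc Suc by (simp only: var_def)
  also have "\<dots> = Poly_Mapping.single (Poly_Mapping.single i 1 + Poly_Mapping.single i n) 1"
    by (simp only: mult_single mult_1)
  finally have "var i ^ Suc n = Poly_Mapping.single (Poly_Mapping.single i 1 + Poly_Mapping.single i n) 1" .
  then show ?case
    by (simp add: single_add[symmetric])
qed simp

definition row_exponent :: "cell set \<Rightarrow> nat \<Rightarrow>\<^sub>0 nat" where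
  "row_exponent T = (\<Sum>i \<in> fst ` T. Poly_Mapping.single i (rwt T i))"

lemma row_monomial_eq_single: "row_monomial T = Poly_Mapping.single (row_exponent T) 1"
proof -
  have "(\<Prod>i \<in> I. var i ^ f i) = Poly_Mapping.single (\<Sum>i \<in> I. Poly_Mapping.single i (f i)) 1"
    for I :: "nat set" and f
    by (induction I rule: infinite_finite_induct) (simp_all add: var_power mult_single)
  then show ?thesis
    by (simp add: row_monomial_def row_exponent_def)
qed

lemma lookup_row_exponent:
  assumes "finite T"
  shows "Poly_Mapping.lookup (row_exponent T) j = rwt T j"
proof -
  have "Poly_Mapping.lookup (row_exponent T) j = (if j \<in> fst ` T then rwt T j else 0)"
    using assms by (simp add: row_exponent_def lookup_sum lookup_single when_def)
  moreover have "rwt T j = 0" if "j \<notin> fst ` T"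
  proof -
    have "{c. (j, c) \<in> T} = {}"
      using that by force
    then show ?thesis
      by (simp only: rwt_def card.empty)
  qed
  ultimately show ?thesis
    by auto
qed

lemma diagram_kohnert_diagrams:
  assumes "T \<in> kohnert_diagrams D" "diagram D"
  shows "diagram T"
proof -
  have "kohnert_move\<^sup>*\<^sup>* D T"
    using assms(1) by (simp add: kohnert_diagrams_def)
  then show ?thesis
    using assms(2) by induction (auto dest: diagram_kohnert_move)
qed

text \<open>Each diagram contributes one monomial with coefficient 1, so the coefficient at
  \<open>m\<close> counts the diagrams with exponent vector \<open>m\<close>; for finite diagrams
  that vector and \<open>rwt\<close> determine each other.\<close>

lemma multiplicity_free_iff_inj_on_rwt:
  assumes "diagram D"
  shows "monomial_multiplicity_free (kohnert_polynomial D) \<longleftrightarrow> inj_on rwt (kohnert_diagrams D)"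
proof -
  let ?P = "kohnert_diagrams D"
  have fin: "finite ?P"
    using assms by (rule finite_kohnert_diagrams)
  have finT: "finite T" if "T \<in> ?P" for T
    using diagram_kohnert_diagrams[OF that assms] by (simp add: diagram_def)
  have exp_eq: "row_exponent S = row_exponent T \<longleftrightarrow> rwt S = rwt T"
    if "S \<in> ?P" "T \<in> ?P" for S T
    using that by (auto simp: poly_mapping_eq_iff fun_eq_iff lookup_row_exponent finT)
  have coeff: "Poly_Mapping.lookup (kohnert_polynomial D) m
      = int (card {T \<in> ?P. row_exponent T = m})" for m
  proof -
    have "Poly_Mapping.lookup (kohnert_polynomial D) m
        = (\<Sum>T \<in> ?P. if row_exponent T = m then 1 else 0)"
      by (simp add: kohnert_polynomial_def lookup_sum row_monomial_eq_single lookup_single when_def eq_commute)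
    also have "\<dots> = int (card {T \<in> ?P. row_exponent T = m})"
      using fin by (simp add: sum.inter_filter[symmetric])
    finally show ?thesis .
  qed
  have "monomial_multiplicity_free (kohnert_polynomial D)
      \<longleftrightarrow> (\<forall>m. card {T \<in> ?P. row_exponent T = m} \<le> 1)"
    by (auto simp: monomial_multiplicity_free_def coeff le_Suc_eq)
  also have "\<dots> \<longleftrightarrow> (\<forall>m. \<forall>S T. S \<in> ?P \<and> row_exponent S = m \<longrightarrow> T \<in> ?P \<and> row_exponent T = m \<longrightarrow> S = T)"
  proof (intro all_cong1)
    fix m
    have "finite {T \<in> ?P. row_exponent T = m}"
      using fin by simp
    then show "card {T \<in> ?P. row_exponent T = m} \<le> 1 \<longleftrightarrow>
        (\<forall>S T. S \<in> ?P \<and> row_exponent S = m \<longrightarrow> T \<in> ?P \<and> row_exponent T = m \<longrightarrow> S = T)"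
      by (subst One_nat_def, subst card_le_Suc0_iff_eq) auto
  qed
  also have "\<dots> \<longleftrightarrow> inj_on rwt ?P"
    unfolding inj_on_def using exp_eq by blast
  finally show ?thesis .
qed

lemma rwt_insert:
  assumes "finite T" "(i, c) \<notin> T"
  shows "rwt (insert (i, c) T) j = rwt T j + of_bool (i = j)"
proof (cases "i = j")
  case True
  have "{c'. (j, c') \<in> insert (i, c) T} = insert c {c'. (j, c') \<in> T}"
    using True by auto
  moreover have "finite {c'. (j, c') \<in> T}"
    using assms(1) by (rule finite_subset[rotated, OF finite_imageI[of _ snd]]) force
  ultimately show ?thesis
    using assms(2) True by (simp add: rwt_def)
qed (simp add: rwt_def)

section \<open>A pattern gives two Kohnert diagrams of the same weight\<close>

lemma kohnert_move_dropI:
  assumes "rightmost_in_row T s c" "empty_position T (g, c)" "g < s"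
  obtains g' where "g \<le> g'" "g' < s" "empty_position T (g', c)"
    "kohnert_move T (insert (g', c) (T - {(s, c)}))"
proof -
  define H where "H = {q. q < s \<and> empty_position T (q, c)}"
  have H: "finite H" "g \<in> H"
    using assms by (auto simp: H_def)
  then have "Max H \<in> H" "\<And>q. q \<in> H \<Longrightarrow> q \<le> Max H"
    using Max_in[of H] by fastforce+
  then have "Max H < s" "empty_position T (Max H, c)"
    "\<And>q. q < s \<Longrightarrow> empty_position T (q, c) \<Longrightarrow> q \<le> Max H"
    by (auto simp: H_def)
  then have "kohnert_move T (insert (Max H, c) (T - {(s, c)}))"
    using assms(1) unfolding kohnert_move_def by blast
  with \<open>\<And>q. q \<in> H \<Longrightarrow> q \<le> Max H\<close> H \<open>Max H < s\<close> \<open>empty_position T (Max H, c)\<close> that show thesis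
    by blast
qed

lemma rightmost_in_row_last_column:
  assumes "T \<subseteq> A \<times> {..M}" "(s, M) \<in> T"
  shows "rightmost_in_row T s M"
  using assms unfolding rightmost_in_row_def by auto

text \<open>A cell of column \<open>M\<close> is always rightmost in its row, so it can go down
  through empty positions one row at a time.\<close>

lemma lower_in_last_column:
  assumes "T \<subseteq> UNIV \<times> {..M}" "(s, M) \<in> T" "1 \<le> t" "t \<le> s" "1 \<le> M"
    and "\<And>r. t \<le> r \<Longrightarrow> r < s \<Longrightarrow> (r, M) \<notin> T"
  shows "kohnert_move\<^sup>*\<^sup>* T (insert (t, M) (T - {(s, M)}))"
  using assms
proof (induction "s - t" arbitrary: T s)
  case 0
  then have "insert (t, M) (T - {(s, M)}) = T"
    by auto
  then show ?case
    by simp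
next
  case (Suc n)
  let ?T = "insert (s - 1, M) (T - {(s, M)})"
  have "t < s"
    using Suc.hyps(2) by simp
  then have emp: "empty_position T (s - 1, M)"
    using Suc.prems by (auto simp: empty_position_def positions_def)
  then have "kohnert_move T ?T"
    using rightmost_in_row_last_column[OF Suc.prems(1,2)] \<open>t < s\<close>
    unfolding kohnert_move_def by (intro exI[of _ s] exI[of _ M] exI[of _ "s - 1"]) auto
  moreover have "kohnert_move\<^sup>*\<^sup>* ?T (insert (t, M) (?T - {(s - 1, M)}))"
    using Suc.hyps(2) Suc.prems \<open>t < s\<close> by (intro Suc.hyps(1)) auto
  moreover have "insert (t, M) (?T - {(s - 1, M)}) = insert (t, M) (T - {(s, M)})"
    using emp by (auto simp: empty_position_def)
  ultimately show ?case
    by (simp add: converse_rtranclp_into_rtranclp)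
qed

text \<open>Row \<open>r1\<close> is emptied from the right. Each move alters only the column of the
  moved cell, so the holes assumed in the other columns survive.\<close>

lemma clear_row:
  assumes "finite T" "\<And>c. c > c1 \<Longrightarrow> (r1, c) \<in> T \<Longrightarrow> \<exists>g<r1. empty_position T (g, c)"
  shows "\<exists>E. kohnert_move\<^sup>*\<^sup>* T E \<and> (\<forall>c>c1. (r1, c) \<notin> E) \<and>
    (\<forall>r c. r > r1 \<or> c \<le> c1 \<or> (r1, c) \<notin> T \<longrightarrow> ((r, c) \<in> E \<longleftrightarrow> (r, c) \<in> T))"
  using assms
proof (induction "card {c. c > c1 \<and> (r1, c) \<in> T}" arbitrary: T rule: less_induct)
  case less
  let ?C = "{c. c > c1 \<and> (r1, c) \<in> T}"
  have fin: "finite ?C"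
    using less.prems(1) by (rule finite_subset[rotated, OF finite_imageI[of _ snd]]) force
  show ?case
  proof (cases "?C = {}")
    case True
    then show ?thesis
      by (intro exI[of _ T]) auto
  next
    case False
    define m where "m = Max ?C"
    have m: "m \<in> ?C" "\<And>c. c \<in> ?C \<Longrightarrow> c \<le> m"
      using fin False Max_in[OF fin False] by (auto simp: m_def)
    then have right: "rightmost_in_row T r1 m"
      unfolding rightmost_in_row_def by (metis (mono_tags, lifting) leI le_trans less_imp_le mem_Collect_eq)
    obtain g where "g < r1" "empty_position T (g, m)"
      using less.prems(2) m(1) by auto
    with right obtain g' where g': "g' < r1" "empty_position T (g', m)"
      "kohnert_move T (insert (g', m) (T - {(r1, m)}))"
      by (metis kohnert_move_dropI)
    let ?T = "insert (g', m) (T - {(r1, m)})"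
    have C: "{c. c > c1 \<and> (r1, c) \<in> ?T} = ?C - {m}"
      using g'(1) by auto
    have "card {c. c > c1 \<and> (r1, c) \<in> ?T} < card ?C"
      unfolding C using fin m(1) by (rule card_Diff1_less)
    moreover have "\<exists>g<r1. empty_position ?T (g, c)" if c: "c > c1" "(r1, c) \<in> ?T" for c
    proof -
      have "c \<noteq> m" "(r1, c) \<in> T"
        using c g'(1) by auto
      with less.prems(2)[OF c(1)] show ?thesis
        by (auto simp: empty_position_def)
    qed
    ultimately obtain E where E: "kohnert_move\<^sup>*\<^sup>* ?T E" "\<forall>c>c1. (r1, c) \<notin> E"
      "\<And>r c. r > r1 \<or> c \<le> c1 \<or> (r1, c) \<notin> ?T \<Longrightarrow> ((r, c) \<in> E \<longleftrightarrow> (r, c) \<in> ?T)"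
      using less.hyps[of ?T] less.prems(1) by blast
    have "(r, c) \<in> E \<longleftrightarrow> (r, c) \<in> T" if "r > r1 \<or> c \<le> c1 \<or> (r1, c) \<notin> T" for r c
      using E(3)[of r c] that g'(1) m(1) by auto
    with E g'(3) show ?thesis
      by (intro exI[of _ E]) (auto intro: converse_rtranclp_into_rtranclp)
  qed
qed

text \<open>A cell in row \<open>r\<close> lands at \<open>g2\<close> or higher, so
  \<open>g1\<close> stays empty and ensures that a cell in row \<open>r - 1\<close> can still move
  afterwards.\<close>

lemma clear_two_in_last_column:
  assumes "T \<subseteq> UNIV \<times> {..M}" "g1 < g2" "g2 \<le> r" "empty_position T (g1, M)" "empty_position T (g2, M)"
  shows "\<exists>E. kohnert_move\<^sup>*\<^sup>* T E \<and> (r, M) \<notin> E \<and> (r - 1, M) \<notin> E \<and>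
    (\<forall>q c. q > r \<or> c \<noteq> M \<longrightarrow> ((q, c) \<in> E \<longleftrightarrow> (q, c) \<in> T))"
proof -
  have "\<exists>E. kohnert_move\<^sup>*\<^sup>* T E \<and> (r, M) \<notin> E \<and> empty_position E (g1, M) \<and> E \<subseteq> UNIV \<times> {..M} \<and>
    (\<forall>q c. q > r \<or> c \<noteq> M \<longrightarrow> ((q, c) \<in> E \<longleftrightarrow> (q, c) \<in> T))"
  proof (cases "(r, M) \<in> T")
    case True
    then have "g2 < r"
      using assms(3,5) by (auto simp: empty_position_def le_less)
    obtain g' where g': "g2 \<le> g'" "g' < r" "kohnert_move T (insert (g', M) (T - {(r, M)}))"
      using kohnert_move_dropI[OF rightmost_in_row_last_column[OF assms(1) True] assms(5) \<open>g2 < r\<close>]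
      by metis
    then show ?thesis
      using assms by (intro exI[of _ "insert (g', M) (T - {(r, M)})"]) (auto simp: empty_position_def)
  next
    case False
    then show ?thesis
      using assms by (intro exI[of _ T]) auto
  qed
  then obtain E where E: "kohnert_move\<^sup>*\<^sup>* T E" "(r, M) \<notin> E" "empty_position E (g1, M)"
    "E \<subseteq> UNIV \<times> {..M}" "\<And>q c. q > r \<or> c \<noteq> M \<Longrightarrow> ((q, c) \<in> E \<longleftrightarrow> (q, c) \<in> T)"
    by auto
  show ?thesis
  proof (cases "(r - 1, M) \<in> E")
    case True
    then have "g1 \<noteq> r - 1"
      using E(3) by (auto simp: empty_position_def)
    then have "g1 < r - 1"
      using assms(2,3) by linarith
    obtain g' where g': "g' < r - 1" "kohnert_move E (insert (g', M) (E - {(r - 1, M)}))"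
      using kohnert_move_dropI[OF rightmost_in_row_last_column[OF E(4) True] E(3) \<open>g1 < r - 1\<close>]
      by metis
    then show ?thesis
      using E by (intro exI[of _ "insert (g', M) (E - {(r - 1, M)})"]) auto
  next
    case False
    then show ?thesis
      using E by (intro exI[of _ E]) auto
  qed
qed

lemma card_ge_2_obtain_less:
  fixes A :: "nat set"
  assumes "2 \<le> card A"
  obtains x y where "x \<in> A" "y \<in> A" "x < y"
proof -
  obtain x y where "x \<in> A" "y \<in> A" "x \<noteq> y"
    using assms by (auto simp: numeral_2_eq_2 card_le_Suc_iff)
  then show thesis
    using that by (metis nat_neq_iff)
qed

lemma pattern_imp_not_inj_on_rwt:
  assumes D: "diagram D" "northeast D"
    and x: "(r1, c1) \<in> D" "(r2, c2) \<in> D" "r1 < r2" "c1 < c2"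
    and hole: "g < r1" "empty_position D (g, c1)"
    and two: "\<And>c. c > c1 \<Longrightarrow> 2 \<le> card {r. r \<le> r1 \<and> empty_position D (r, c)}"
  shows "\<not> inj_on rwt (kohnert_diagrams D)"
proof -
  have fin: "finite D"
    using D(1) by (auto simp: diagram_def)
  \<comment> \<open>\<open>P\<close> is the pattern with \<open>c1\<close> and \<open>r2\<close>
    fixed and only the lower row left free.\<close>
  define P where "P r \<longleftrightarrow> (r, c1) \<in> D \<and> r < r2 \<and> (\<exists>g<r. empty_position D (g, c1)) \<and>
    (\<forall>c>c1. 2 \<le> card {q. q \<le> r \<and> empty_position D (q, c)})" for r
  define r where "r = (LEAST r. P r)"
  have "P r1"
    using x hole two by (auto simp: P_def)
  then have "P r"
    unfolding r_def by (rule LeastI)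
  then have r: "(r, c1) \<in> D" "r < r2" "\<And>c. c > c1 \<Longrightarrow> 2 \<le> card {q. q \<le> r \<and> empty_position D (q, c)}"
    by (auto simp: P_def)
  obtain g where g: "g < r" "empty_position D (g, c1)"
    using \<open>P r\<close> by (auto simp: P_def)
  then have "1 \<le> g" "1 \<le> c1"
    by (auto simp: empty_position_def positions_def)
  \<comment> \<open>A cell at \<open>(r - 1, c1)\<close> would be a lower occurrence: the hole
    \<open>g\<close> lies below it too, and every column to the right still has two holes.\<close>
  have below: "(r - 1, c1) \<notin> D"
  proof
    assume mem: "(r - 1, c1) \<in> D"
    then have "g \<noteq> r - 1"
      using g(2) by (auto simp: empty_position_def)
    then have gr: "g < r - 1"
      using g(1) by linarith
    have "2 \<le> card {q. q \<le> r - 1 \<and> empty_position D (q, c)}" if "c > c1" for c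
    proof (cases "(r, c) \<in> D")
      case True
      then have "{q. q \<le> r \<and> empty_position D (q, c)} = {q. q \<le> r - 1 \<and> empty_position D (q, c)}"
        using g(1) by (auto simp: empty_position_def) (metis One_nat_def le_Suc_eq Suc_pred' less_nat_zero_code not_gr_zero)
      then show ?thesis
        using r(3)[OF that] by simp
    next
      case False
      \<comment> \<open>By the northeast condition with \<open>(r, c1)\<close>, a cell of column
        \<open>c\<close> up to row \<open>r\<close> would force \<open>(r, c)\<close>. So the column
        is empty there.\<close>
      have "(q, c) \<notin> D" if "q \<le> r" for q
      proof
        assume "(q, c) \<in> D"
        with r(1) D(2) have "(max r q, max c1 c) \<in> D"
          by (auto simp: northeast_def)
        with False \<open>c > c1\<close> \<open>q \<le> r\<close> show False
          by (simp add: max_def split: if_splits)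
      qed
      then have "{q. q \<le> r - 1 \<and> empty_position D (q, c)} = {1..r - 1}"
        using \<open>c > c1\<close> by (auto simp: empty_position_def positions_def)
      then show ?thesis
        using gr \<open>1 \<le> g\<close> by simp
    qed
    with gr g mem r(2) have "P (r - 1)"
      unfolding P_def by auto
    then have "r \<le> r - 1"
      unfolding r_def by (rule Least_le)
    with g(1) show False
      by simp
  qed
  define M where "M = Max (snd ` D)"
  have "c2 \<le> M"
    using fin x(2) unfolding M_def by (intro Max_ge) force+
  then have "c1 < M"
    using x(4) by simp
  have le_M: "c \<le> M" if "(q, c) \<in> D" for q c
    using fin that unfolding M_def by (intro Max_ge) force+
  obtain q where "(q, M) \<in> D"
    using Max_in[of "snd ` D"] fin x(2) unfolding M_def by fastforce
  with x(2) D(2) have "(max r2 q, max c2 M) \<in> D"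
    by (auto simp: northeast_def)
  then have top: "(max r2 q, M) \<in> D"
    using \<open>c2 \<le> M\<close> by (simp add: max_def)
  \<comment> \<open>The next cell of column \<open>M\<close> above row \<open>r\<close>; one exists
    since \<open>r < r2\<close> and the northeast condition puts a cell of column \<open>M\<close>
    at row \<open>r2\<close> or higher.\<close>
  define s where "s = (LEAST s. r < s \<and> (s, M) \<in> D)"
  have s: "r < s" "(s, M) \<in> D"
    unfolding s_def using LeastI[of "\<lambda>s. r < s \<and> (s, M) \<in> D" "max r2 q"] top r(2) by auto
  have s_least: "(p, M) \<notin> D" if "r < p" "p < s" for p
    using that not_less_Least[of p "\<lambda>s. r < s \<and> (s, M) \<in> D"] unfolding s_def by auto
  obtain g1 g2 where g12: "g1 < g2" "g2 \<le> r" "empty_position D (g1, M)" "empty_position D (g2, M)"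
    using card_ge_2_obtain_less[OF r(3)[OF \<open>c1 < M\<close>]] by blast
  have DM: "D \<subseteq> UNIV \<times> {..M}"
    using le_M by auto
  \<comment> \<open>Column \<open>M\<close> is treated first: once it has no cell in row
    \<open>r\<close>, \<open>clear_row\<close> leaves it untouched.\<close>
  obtain E1 where E1: "kohnert_move\<^sup>*\<^sup>* D E1" "(r, M) \<notin> E1" "(r - 1, M) \<notin> E1"
    "\<And>q c. q > r \<or> c \<noteq> M \<Longrightarrow> ((q, c) \<in> E1 \<longleftrightarrow> (q, c) \<in> D)"
    using clear_two_in_last_column[OF DM g12] by metis
  have "diagram E1"
    using diagram_kohnert_diagrams[OF _ D(1)] E1(1) by (simp add: kohnert_diagrams_def)
  have "\<exists>g<r. empty_position E1 (g, c)" if c: "c > c1" "(r, c) \<in> E1" for c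
  proof -
    have "c \<noteq> M"
      using c(2) E1(2) by auto
    then have same: "(q, c) \<in> E1 \<longleftrightarrow> (q, c) \<in> D" for q
      using E1(4) by simp
    obtain h1 h2 where "h1 < h2" "h2 \<le> r" "empty_position D (h1, c)"
      using card_ge_2_obtain_less[OF r(3)[OF c(1)]] by blast
    then show ?thesis
      using same by (intro exI[of _ h1]) (auto simp: empty_position_def)
  qed
  then obtain E where E: "kohnert_move\<^sup>*\<^sup>* E1 E" "\<forall>c>c1. (r, c) \<notin> E"
    "\<And>q c. q > r \<or> c \<le> c1 \<or> (r, c) \<notin> E1 \<Longrightarrow> ((q, c) \<in> E \<longleftrightarrow> (q, c) \<in> E1)"
    using clear_row[of E1 c1 r] \<open>diagram E1\<close> unfolding diagram_def by metis
  have DE: "kohnert_move\<^sup>*\<^sup>* D E"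
    using E1(1) E(1) by simp
  then have dE: "diagram E"
    using diagram_kohnert_diagrams[OF _ D(1)] by (simp add: kohnert_diagrams_def)
  have "E \<subseteq> {..Max (fst ` D)} \<times> {..M}"
  proof (rule kohnert_diagrams_subset)
    show "E \<in> kohnert_diagrams D"
      using DE by (simp add: kohnert_diagrams_def)
    show "D \<subseteq> {..Max (fst ` D)} \<times> {..M}"
      using fin le_M by (auto intro!: Max_ge rev_image_eqI)
  qed
  then have EM: "E \<subseteq> UNIV \<times> {..M}"
    by auto
  have cells: "(r, c1) \<in> E" "(r - 1, c1) \<notin> E" "(r, M) \<notin> E" "(r - 1, M) \<notin> E" "(s, M) \<in> E"
    and gap: "\<And>p. r < p \<Longrightarrow> p < s \<Longrightarrow> (p, M) \<notin> E"
    using E E1 r(1) below s s_least \<open>c1 < M\<close> by auto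
  have "2 \<le> r"
    using g(1) \<open>1 \<le> g\<close> by simp
  \<comment> \<open>\<open>F\<close> is the common part; \<open>A\<close> and \<open>B\<close>
    exchange the rows \<open>r\<close> and \<open>r - 1\<close> between the columns
    \<open>c1\<close> and \<open>M\<close>.\<close>
  define F where "F = E - {(s, M), (r, c1)}"
  define A where "A = insert (r, M) (insert (r - 1, c1) F)"
  define B where "B = insert (r - 1, M) (insert (r, c1) F)"
  have finF: "finite F"
    using dE by (simp add: F_def diagram_def)
  have "kohnert_move\<^sup>*\<^sup>* E B"
  proof -
    have "kohnert_move\<^sup>*\<^sup>* E (insert (r - 1, M) (E - {(s, M)}))"
    proof (rule lower_in_last_column)
      show "(p, M) \<notin> E" if "r - 1 \<le> p" "p < s" for p
      proof -
        have "p = r - 1 \<or> p = r \<or> r < p"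
          using that(1) by linarith
        then show ?thesis
          using cells gap that by auto
      qed
    qed (use EM cells \<open>2 \<le> r\<close> s(1) \<open>c1 < M\<close> in auto)
    moreover have "insert (r - 1, M) (E - {(s, M)}) = B"
      using cells s(1) by (auto simp: B_def F_def)
    ultimately show ?thesis
      by simp
  qed
  moreover have "kohnert_move\<^sup>*\<^sup>* E A"
  proof -
    let ?E = "insert (r - 1, c1) (E - {(r, c1)})"
    have "kohnert_move E ?E"
    proof -
      have "rightmost_in_row E r c1"
        unfolding rightmost_in_row_def using cells(1) E(2) by (metis leI)
      moreover have "empty_position E (r - 1, c1)"
        using cells(2) \<open>2 \<le> r\<close> \<open>1 \<le> c1\<close> by (simp add: empty_position_def positions_def)
      moreover have "r - 1 < r" "\<forall>p<r. empty_position E (p, c1) \<longrightarrow> p \<le> r - 1"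
        using \<open>2 \<le> r\<close> by auto
      ultimately show ?thesis
        unfolding kohnert_move_def by blast
    qed
    moreover have "kohnert_move\<^sup>*\<^sup>* ?E (insert (r, M) (?E - {(s, M)}))"
    proof (rule lower_in_last_column)
      show "(p, M) \<notin> ?E" if "r \<le> p" "p < s" for p
        using cells gap that \<open>c1 < M\<close> by (cases "p = r") auto
    qed (use EM cells \<open>2 \<le> r\<close> s(1) \<open>c1 < M\<close> in auto)
    moreover have "insert (r, M) (?E - {(s, M)}) = A"
      using cells s(1) \<open>c1 < M\<close> by (auto simp: A_def F_def)
    ultimately show ?thesis
      by simp
  qed
  ultimately have "A \<in> kohnert_diagrams D" "B \<in> kohnert_diagrams D"
    using DE by (auto simp: kohnert_diagrams_def)
  moreover have "rwt A = rwt B"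
  proof
    fix j
    have "r - 1 \<noteq> r"
      using \<open>2 \<le> r\<close> by simp
    then have "(r, M) \<notin> insert (r - 1, c1) F" "(r - 1, c1) \<notin> F"
      "(r - 1, M) \<notin> insert (r, c1) F" "(r, c1) \<notin> F"
      using cells by (auto simp: F_def)
    then show "rwt A j = rwt B j"
      using finF by (simp add: A_def B_def rwt_insert)
  qed
  moreover have "A \<noteq> B"
    using \<open>2 \<le> r\<close> \<open>c1 < M\<close> by (auto simp: A_def B_def F_def)
  ultimately show ?thesis
    by (auto simp: inj_on_def)
qed

section \<open>Counting the cells that have crossed a row\<close>

text \<open>Moves keep every cell in its column and only lower it, so the growth of this count since
  the start is the number of cells that have crossed from above row \<open>r\<close>.\<close>

definition cells_below :: "cell set \<Rightarrow> nat \<Rightarrow> nat \<Rightarrow> nat" where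
  "cells_below T c r = card {s \<in> {1..r}. (s, c) \<in> T}"

lemma cells_below_0 [simp]: "cells_below T c 0 = 0"
  by (simp add: cells_below_def)

lemma cells_below_Suc [simp]:
  "cells_below T c (Suc r) = cells_below T c r + of_bool ((Suc r, c) \<in> T)"
proof -
  have "{s \<in> {1..Suc r}. (s, c) \<in> T} =
      (if (Suc r, c) \<in> T then insert (Suc r) {s \<in> {1..r}. (s, c) \<in> T} else {s \<in> {1..r}. (s, c) \<in> T})"
    by (auto simp: le_Suc_eq)
  then show ?thesis
    by (simp add: cells_below_def)
qed

lemma cells_below_le: "cells_below T c r \<le> r"
  by (induction r) auto

lemma cells_below_mono: "r \<le> s \<Longrightarrow> cells_below T c r \<le> cells_below T c s"
  by (induction s rule: dec_induct) auto

lemma cells_below_less: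
  assumes "(s, c) \<in> T" "r < s"
  shows "cells_below T c r < cells_below T c s"
proof -
  obtain t where "s = Suc t"
    using assms(2) by (cases s) auto
  then show ?thesis
    using assms cells_below_mono[of r t T c] by simp
qed

lemma cells_below_eq:
  assumes "r \<le> s" "\<And>q. r < q \<Longrightarrow> q \<le> s \<Longrightarrow> (q, c) \<notin> T"
  shows "cells_below T c s = cells_below T c r"
  using assms by (induction s rule: dec_induct) auto

lemma cells_below_full_iff: "cells_below T c r = r \<longleftrightarrow> (\<forall>s. 1 \<le> s \<and> s \<le> r \<longrightarrow> (s, c) \<in> T)"
proof (induction r)
  case (Suc r)
  show ?case
    using cells_below_le[of T c r] Suc by (auto simp: le_Suc_eq)
qed simp

lemma cells_below_cong_above:
  assumes "\<And>s. r < s \<Longrightarrow> (s, c) \<in> S \<longleftrightarrow> (s, c) \<in> T"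
    and "cells_below S c R = cells_below T c R" "r \<le> R"
  shows "cells_below S c r = cells_below T c r"
proof -
  \<comment> \<open>An equality of two differences, written additively to avoid truncated
    subtraction.\<close>
  have "cells_below S c s + cells_below T c r = cells_below T c s + cells_below S c r" if "r \<le> s" for s
    using that assms(1) by (induction s rule: dec_induct) auto
  from this[OF assms(3)] assms(2) show ?thesis
    by simp
qed

text \<open>In place of the maximality of the landing row, this form of a move records that the cell
  jumps over a solid run of cells, which is what the invariants need.\<close>

definition drops :: "cell set \<Rightarrow> cell set \<Rightarrow> nat \<Rightarrow> nat \<Rightarrow> nat \<Rightarrow> bool" where
  "drops T T' s e s' \<longleftrightarrow> rightmost_in_row T s e \<and> 1 \<le> s' \<and> s' < s \<and> (s', e) \<notin> T \<and>
    (\<forall>q. s' < q \<longrightarrow> q < s \<longrightarrow> (q, e) \<in> T) \<and> T' = insert (s', e) (T - {(s, e)})"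

lemma kohnert_move_drops:
  assumes "kohnert_move T T'"
  obtains s e s' where "drops T T' s e s'"
proof -
  obtain s e s' where *: "rightmost_in_row T s e" "s' < s" "empty_position T (s', e)"
    "\<forall>q<s. empty_position T (q, e) \<longrightarrow> q \<le> s'" "T' = insert (s', e) (T - {(s, e)})"
    using assms unfolding kohnert_move_def by blast
  have "(q, e) \<in> T" if "s' < q" "q < s" for q
    using *(3) *(4)[rule_format, of q] that by (force simp: empty_position_def positions_def)
  then have "drops T T' s e s'"
    using * by (auto simp: drops_def empty_position_def positions_def)
  then show thesis
    by (rule that)
qed

lemma dropsD:
  assumes "drops T T' s e s'"
  shows "(s, e) \<in> T" "1 \<le> s'" "s' < s" "(s', e) \<notin> T"
    and "\<And>c. (s, c) \<in> T \<Longrightarrow> c \<le> e"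
    and "\<And>q. s' < q \<Longrightarrow> q \<le> s \<Longrightarrow> (q, e) \<in> T"
    and "\<And>r c. (r, c) \<in> T' \<longleftrightarrow> (r, c) = (s', e) \<or> (r, c) \<in> T \<and> (r, c) \<noteq> (s, e)"
  using assms unfolding drops_def rightmost_in_row_def by (auto simp: le_less)

lemma cells_below_drops:
  assumes "drops T T' s e s'"
  shows "cells_below T' c r = cells_below T c r + of_bool (c = e \<and> s' \<le> r \<and> r < s)"
proof (induction r)
  case 0
  then show ?case
    using dropsD(2)[OF assms] by simp
next
  case (Suc r)
  show ?case
    using dropsD(1-4)[OF assms] by (auto simp: Suc dropsD(7)[OF assms] less_Suc_eq le_Suc_eq not_less of_bool_def)
qed

text \<open>Above row \<open>\<kappa> c\<close>, a column \<open>c\<close> left of the last one has at most one cell, in the top row.\<close>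

locale cleared_rows =
  fixes D :: "cell set" and R M :: nat and \<kappa> :: "nat \<Rightarrow> nat"
  assumes D_sub: "D \<subseteq> {1..R} \<times> {1..M}"
    and gap: "c < M \<Longrightarrow> \<kappa> c < r \<Longrightarrow> r < R \<Longrightarrow> (r, c) \<notin> D"
    and kappa_less: "\<kappa> c < R"
begin

text \<open>A column has a surplus at row \<open>r\<close> if some of its cells have come down from above \<open>r\<close>.\<close>

definition surplus :: "cell set \<Rightarrow> nat \<Rightarrow> nat \<Rightarrow> bool" where
  "surplus T c r \<longleftrightarrow> cells_below D c r < cells_below T c r"

definition dominated :: "cell set \<Rightarrow> bool" where
  "dominated T \<longleftrightarrow> T \<subseteq> {1..R} \<times> {1..M} \<and>
    (\<forall>c r. cells_below D c r \<le> cells_below T c r) \<and> (\<forall>c. cells_below T c R = cells_below D c R)"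

text \<open>Call a column eligible in row \<open>r\<close> if it has a cell of \<open>D\<close>
  there or a surplus. By \<open>mem_if_not_surplus\<close> the cells of a dominated diagram lie in
  eligible columns; packed means that they fill an initial segment of these, so rows with the same
  surplus form a chain.\<close>

definition left_packed :: "cell set \<Rightarrow> nat \<Rightarrow> bool" where
  "left_packed T r \<longleftrightarrow>
    (\<forall>c c'. c < c' \<longrightarrow> (r, c') \<in> T \<longrightarrow> (r, c) \<in> D \<or> surplus T c r \<longrightarrow> (r, c) \<in> T)"

lemma not_surplus_self [simp]: "\<not> surplus D c r"
  by (simp add: surplus_def)

lemma dominated_self: "dominated D"
  using D_sub by (simp add: dominated_def)

lemma dominatedD:
  assumes "dominated T"
  shows "cells_below D c r \<le> cells_below T c r" "cells_below T c R = cells_below D c R"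
    and "(r, c) \<in> T \<Longrightarrow> r \<le> R" "(r, c) \<in> T \<Longrightarrow> c \<le> M" "(r, c) \<in> T \<Longrightarrow> 1 \<le> r"
  using assms by (auto simp: dominated_def)

lemma dominated_drops:
  assumes "dominated T" "drops T T' s e s'"
  shows "dominated T'"
proof -
  have "s \<le> R" "e \<le> M" "s' \<le> R" "1 \<le> e"
    using assms(1) dropsD(1,3)[OF assms(2)] unfolding dominated_def by auto
  then have "T' \<subseteq> {1..R} \<times> {1..M}"
    using assms(1) dropsD(2,7)[OF assms(2)] unfolding dominated_def by auto
  with \<open>s \<le> R\<close> assms(1) show ?thesis
    by (auto simp: dominated_def cells_below_drops[OF assms(2)] trans_le_add1)
qed

lemma surplus_drops:
  assumes "dominated T" "drops T T' s e s'"
  shows "surplus T' c r \<longleftrightarrow> surplus T c r \<or> c = e \<and> s' \<le> r \<and> r < s"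
  using dominatedD(1)[OF assms(1), of c r]
  by (auto simp: surplus_def cells_below_drops[OF assms(2)])

text \<open>Each row passed adds one to the count of \<open>T\<close> and at most one to that of
  \<open>D\<close>.\<close>

lemma surplus_upwards:
  assumes "surplus T c r" "r \<le> t" "\<And>q. r < q \<Longrightarrow> q \<le> t \<Longrightarrow> (q, c) \<in> T"
  shows "surplus T c t"
  using assms(2,1,3) by (induction t rule: dec_induct) (auto simp: surplus_def of_bool_def)

text \<open>The counts up to row \<open>r\<close> agree; if \<open>D\<close> lacked the cell,
  \<open>T\<close> would fall behind \<open>D\<close> one row lower.\<close>

lemma mem_if_not_surplus:
  assumes "dominated T" "(r, c) \<in> T" "\<not> surplus T c r"
  shows "(r, c) \<in> D"
proof -
  obtain q where "r = Suc q"
    using dominatedD(5)[OF assms(1,2)] by (cases r) auto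
  then show ?thesis
    using assms dominatedD(1)[OF assms(1), of c q] by (auto simp: surplus_def of_bool_def split: if_splits)
qed

lemma cells_below_gap:
  assumes "c < M" "\<kappa> c \<le> r" "r < R"
  shows "cells_below D c r = cells_below D c (\<kappa> c)"
  using assms gap by (intro cells_below_eq) auto

lemma cells_below_top:
  assumes "c < M" "dominated T"
  shows "cells_below T c R \<le> Suc (cells_below D c (\<kappa> c))"
proof -
  obtain q where "R = Suc q"
    using kappa_less[of c] by (cases R) auto
  then show ?thesis
    using cells_below_gap[OF assms(1), of q] kappa_less[of c] dominatedD(2)[OF assms(2), of c] by simp
qed

text \<open>A surplus at \<open>q\<close> means that all cells of column \<open>c\<close>, a former
  top cell included, are already in rows up to \<open>q\<close>. But then the column is eligible in
  row \<open>s\<close>, and packedness yields one cell too many.\<close>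

lemma not_surplus_below_packed:
  assumes "dominated T" "left_packed T s" "(s, e) \<in> T" "c < e" "\<kappa> c \<le> q" "q < s"
  shows "\<not> surplus T c q"
proof
  assume sur: "surplus T c q"
  have "s \<le> R" "c < M"
    using dominatedD(3,4)[OF assms(1,3)] assms(4) by auto
  then have "q < R"
    using assms(6) by simp
  have *: "Suc (cells_below D c (\<kappa> c)) \<le> cells_below T c q"
    using sur cells_below_gap[OF \<open>c < M\<close> assms(5) \<open>q < R\<close>] by (simp add: surplus_def)
  have "(s, c) \<in> D \<or> surplus T c s"
  \<comment> \<open>The top row never has a surplus, so there eligibility must come from a cell of
    \<open>D\<close>.\<close>
  proof (cases "s = R")
    case True
    obtain p where p: "R = Suc p"
      using \<open>q < R\<close> by (cases R) auto
    have "cells_below D c R \<noteq> cells_below D c (\<kappa> c)"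
      using * cells_below_mono[of q R T c] \<open>q < R\<close> dominatedD(2)[OF assms(1), of c] by simp
    then have "(R, c) \<in> D"
      using p cells_below_gap[OF \<open>c < M\<close>, of p] assms(5) \<open>q < R\<close> by (auto simp: of_bool_def split: if_splits)
    with True show ?thesis
      by simp
  next
    case False
    then have "cells_below D c s = cells_below D c (\<kappa> c)"
      using \<open>s \<le> R\<close> assms(5,6) by (intro cells_below_gap[OF \<open>c < M\<close>]) auto
    with * show ?thesis
      using cells_below_mono[of q s T c] assms(6) by (simp add: surplus_def)
  qed
  then have "(s, c) \<in> T"
    using assms(2-4) by (auto simp: left_packed_def)
  then have "cells_below T c q < cells_below T c s"
    using assms(6) by (rule cells_below_less)
  moreover have "cells_below T c s \<le> cells_below T c R"
    using \<open>s \<le> R\<close> by (rule cells_below_mono)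
  ultimately show False
    using * cells_below_top[OF \<open>c < M\<close> assms(1)] by simp
qed

text \<open>Row \<open>s\<close> only loses its last cell, and column \<open>e\<close> gains a
  surplus only in rows where it is now filled. The new cell in the landing row is what the last
  assumption is for.\<close>

lemma left_packed_drops:
  assumes T: "dominated T" "drops T T' s e s'" and "left_packed T r"
    and "\<And>c. r = s' \<Longrightarrow> c < e \<Longrightarrow> (r, c) \<in> D \<or> surplus T c r \<Longrightarrow> (r, c) \<in> T"
  shows "left_packed T' r"
  unfolding left_packed_def
proof (intro allI impI)
  fix c c'
  assume c: "c < c'" "(r, c') \<in> T'" and "(r, c) \<in> D \<or> surplus T' c r"
  note d = dropsD[OF T(2)]
  from \<open>(r, c) \<in> D \<or> surplus T' c r\<close>
  consider "(r, c) \<in> D \<or> surplus T c r" | "c = e" "s' \<le> r" "r < s"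
    using surplus_drops[OF T] by blast
  then show "(r, c) \<in> T'"
  proof cases
    case 1
    show ?thesis
    proof (cases "(r, c') = (s', e)")
      case True
      then have "(r, c) \<in> T"
        using assms(4)[of c] 1 c(1) by simp
      then show ?thesis
        using True c(1) by (auto simp: d(7))
    next
      case False
      then have c': "(r, c') \<in> T"
        using c(2) by (auto simp: d(7))
      then have "(r, c) \<in> T"
        using assms(3) 1 c(1) unfolding left_packed_def by blast
      moreover have "(r, c) \<noteq> (s, e)"
        using d(5)[of c'] c' c(1) by auto
      ultimately show ?thesis
        by (simp add: d(7))
    qed
  next
    case 2
    then show ?thesis
      using d(6)[of r] by (cases "r = s'") (auto simp: d(7))
  qed
qed

text \<open>In row \<open>s\<close>, the cell \<open>(q, b)\<close> would block the move; below
  \<open>s\<close>, the jumped-over \<open>(q, e)\<close> and \<open>(s, e)\<close> would be two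
  cells above row \<open>\<kappa> e\<close>; above \<open>s\<close>, the surplus of column
  \<open>e\<close> at \<open>s\<close> would contradict the packedness of row
  \<open>q\<close>.\<close>

lemma no_cells_right_of_crossing:
  assumes T: "dominated T" "drops T T' s e s'"
    and e: "e < b" "b \<le> M" "s' \<le> \<kappa> e" "\<kappa> e < s"
    and packed: "\<And>q. \<kappa> e < q \<Longrightarrow> left_packed T q" and q: "\<kappa> e < q"
  shows "(q, b) \<notin> T"
proof
  assume b: "(q, b) \<in> T"
  note d = dropsD[OF T(2)]
  have "s \<le> R" "q \<le> R" "e < M"
    using dominatedD(3)[OF T(1) d(1)] dominatedD(3)[OF T(1) b] e by auto
  have s: "Suc (cells_below D e (\<kappa> e)) \<le> cells_below T e s"
    using cells_below_less[OF d(1) e(4)] dominatedD(1)[OF T(1), of e "\<kappa> e"] by simp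
  consider "q = s" | "q < s" | "s < q"
    by linarith
  then show False
  proof cases
    case 1
    then show ?thesis
      using d(5)[of b] b e(1) by simp
  next
    case 2
    then have "(q, e) \<in> T"
      using q e(3) by (intro d(6)) auto
    then have "cells_below T e (\<kappa> e) < cells_below T e q"
      using q by (rule cells_below_less)
    moreover have "cells_below T e q < cells_below T e s"
      using d(1) 2 by (rule cells_below_less)
    moreover have "cells_below T e s \<le> cells_below T e R"
      using \<open>s \<le> R\<close> by (rule cells_below_mono)
    ultimately show ?thesis
      using cells_below_top[OF \<open>e < M\<close> T(1)] dominatedD(1)[OF T(1), of e "\<kappa> e"] by simp
  next
    case 3
    then have "surplus T e s"
      using s cells_below_gap[OF \<open>e < M\<close>, of s] e(4) \<open>q \<le> R\<close> by (simp add: surplus_def)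
    moreover have "\<not> surplus T e s"
      using not_surplus_below_packed[OF T(1) packed[OF q] b e(1)] e(4) 3 by simp
    ultimately show ?thesis
      by simp
  qed
qed

text \<open>In the highest row where \<open>S\<close> and \<open>T\<close> differ, the column totals
  and the agreement above give equal surplus, and two different rows of equal size are incomparable
  under inclusion.\<close>

lemma inj_on_rwtI:
  assumes dom: "\<And>T. T \<in> P \<Longrightarrow> dominated T"
    and chain: "\<And>S T r c c'. S \<in> P \<Longrightarrow> T \<in> P \<Longrightarrow> 1 \<le> r \<Longrightarrow> c < c' \<Longrightarrow>
      (\<And>q. surplus S q r = surplus T q r) \<Longrightarrow>
      (r, c) \<in> S \<Longrightarrow> (r, c) \<notin> T \<Longrightarrow> (r, c') \<notin> S \<Longrightarrow> (r, c') \<in> T \<Longrightarrow> False"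
  shows "inj_on rwt P"
proof (rule inj_onI, rule ccontr)
  fix S T
  assume P: "S \<in> P" "T \<in> P" and rwt: "rwt S = rwt T" and "S \<noteq> T"
  define X where "X = fst ` ((S - T) \<union> (T - S))"
  have "finite S" "finite T"
    using dom[OF P(1)] dom[OF P(2)] unfolding dominated_def by (auto intro: finite_subset)
  then have X: "finite X" "X \<noteq> {}"
    using \<open>S \<noteq> T\<close> by (auto simp: X_def)
  define r where "r = Max X"
  have "r \<in> X"
    using X unfolding r_def by (rule Max_in)
  then have r: "1 \<le> r" "r \<le> R"
    using dominatedD(3,5)[OF dom[OF P(1)]] dominatedD(3,5)[OF dom[OF P(2)]] by (auto simp: X_def)
  have above: "(s, c) \<in> S \<longleftrightarrow> (s, c) \<in> T" if "r < s" for s c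
  proof (rule ccontr)
    assume "\<not> ?thesis"
    then have "s \<in> X"
      unfolding X_def by force
    then have "s \<le> r"
      unfolding r_def using X(1) by simp
    with that show False
      by simp
  qed
  have sur: "surplus S q r = surplus T q r" for q
  proof -
    have "cells_below S q r = cells_below T q r"
      by (rule cells_below_cong_above[of r q S T R])
        (use above r(2) dominatedD(2)[OF dom[OF P(1)]] dominatedD(2)[OF dom[OF P(2)]] in auto)
    then show ?thesis
      by (simp add: surplus_def)
  qed
  define A B where "A = {c. (r, c) \<in> S}" and "B = {c. (r, c) \<in> T}"
  have "A \<subseteq> snd ` S" "B \<subseteq> snd ` T"
    by (force simp: A_def B_def)+
  then have fin: "finite A" "finite B"
    using \<open>finite S\<close> \<open>finite T\<close> by (auto intro: finite_subset)
  have card: "card A = card B"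
    using fun_cong[OF rwt, of r] by (simp add: rwt_def A_def B_def)
  have "A \<noteq> B"
    using \<open>r \<in> X\<close> by (auto simp: X_def A_def B_def)
  then have "\<not> A \<subseteq> B" "\<not> B \<subseteq> A"
    using card_subset_eq[OF fin(2), of A] card_subset_eq[OF fin(1), of B] card by auto
  then obtain c c' where "(r, c) \<in> S" "(r, c) \<notin> T" "(r, c') \<notin> S" "(r, c') \<in> T"
    by (auto simp: A_def B_def)
  moreover from this have "c < c' \<or> c' < c"
    by (metis nat_neq_iff)
  ultimately show False
    using chain[OF P r(1) _ sur, of c c'] chain[OF P(2,1) r(1) _ sur[symmetric], of c' c] by blast
qed

lemma kohnert_diagrams_invariant:
  assumes "T \<in> kohnert_diagrams D" "I D"
    and "\<And>T T' s e s'. I T \<Longrightarrow> drops T T' s e s' \<Longrightarrow> I T'"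
  shows "I T"
proof -
  have "kohnert_move\<^sup>*\<^sup>* D T"
    using assms(1) by (simp add: kohnert_diagrams_def)
  then show ?thesis
    using assms(2) by induction (auto elim: kohnert_move_drops intro: assms(3))
qed

end

section \<open>A frozen block\<close>

text \<open>
  Column \<open>b\<close> is full up to row \<open>k\<close> and stays so; hence nothing moves in, or enters, the
  rows up to \<open>k\<close> of the columns up to \<open>b\<close>.
\<close>

locale frozen_block = cleared_rows D R M "\<lambda>c. if c \<le> b then k else 0"
  for D R M b k +
  assumes b_le: "b \<le> M"
    and b_full: "1 \<le> r \<Longrightarrow> r \<le> k \<Longrightarrow> (r, b) \<in> D"
    and b_top: "c < b \<Longrightarrow> (R, c) \<in> D \<Longrightarrow> (R, b) \<in> D"
begin

text \<open>Through \<open>frozen_mem_iff\<close>, the last clause makes the block look as in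
  \<open>D\<close>.\<close>

definition inv where
  "inv T \<longleftrightarrow> dominated T \<and> (\<forall>r. left_packed T r) \<and> (\<forall>c r. c \<le> b \<longrightarrow> r \<le> k \<longrightarrow> \<not> surplus T c r)"

lemma k_less: "k < R"
  using kappa_less[of b] by simp

lemma frozen_mem_iff:
  assumes "inv T" "c \<le> b" "r \<le> k"
  shows "(r, c) \<in> T \<longleftrightarrow> (r, c) \<in> D"
proof (cases r)
  case 0
  then show ?thesis
    using assms(1) D_sub by (auto simp: inv_def dominated_def)
next
  case (Suc q)
  have "cells_below T c p = cells_below D c p" if "p \<le> k" for p
    using assms that dominatedD(1)[of T c p] by (auto simp: inv_def surplus_def le_less)
  from this[of r] this[of q] show ?thesis
    using Suc assms(3) by (auto simp: of_bool_def split: if_splits)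
qed

text \<open>As column \<open>b\<close> is full, such a cell would come from above row
  \<open>k\<close> and from a column left of \<open>b\<close>. That column then had a top cell in
  \<open>D\<close>, hence by \<open>b_top\<close> so had \<open>b\<close>, which keeps a cell above
  row \<open>k\<close>, against \<open>no_cells_right_of_crossing\<close>.\<close>

lemma not_drops_into_block:
  assumes T: "inv T" "drops T T' s e s'" and "e \<le> b"
  shows "k < s'"
proof (rule ccontr)
  assume "\<not> k < s'"
  note d = dropsD[OF T(2)]
  have dom: "dominated T"
    using T(1) by (simp add: inv_def)
  have s': "(s', b) \<in> T"
    using frozen_mem_iff[OF T(1), of b s'] b_full[OF d(2)] \<open>\<not> k < s'\<close> by simp
  then have "e < b"
    using d(4) \<open>e \<le> b\<close> by (cases "e = b") auto
  have "k < s"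
  proof (rule ccontr)
    assume "\<not> k < s"
    then have "(s, b) \<in> T"
      using frozen_mem_iff[OF T(1), of b s] b_full d(2,3) by simp
    then show False
      using d(5)[of b] \<open>e < b\<close> by simp
  qed
  have "s \<le> R"
    using dominatedD(3)[OF dom d(1)] .
  have "cells_below D e k < cells_below T e s"
    using cells_below_less[OF d(1) \<open>k < s\<close>] dominatedD(1)[OF dom, of e k] by simp
  also have "\<dots> \<le> cells_below D e R"
    using cells_below_mono[OF \<open>s \<le> R\<close>, of T e] dominatedD(2)[OF dom, of e] by simp
  finally have less: "cells_below D e k < cells_below D e R" .
  have "(R, e) \<in> D"
  proof (rule ccontr)
    assume "(R, e) \<notin> D"
    then have "cells_below D e R = cells_below D e k"
      using gap[of e] \<open>e < b\<close> b_le k_less by (intro cells_below_eq) (auto simp: le_less)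
    with less show False
      by simp
  qed
  then have "(R, b) \<in> D"
    using b_top \<open>e < b\<close> by simp
  then have "cells_below D b k < cells_below T b R"
    using cells_below_less[of R b D k] k_less dominatedD(2)[OF dom, of b] by simp
  moreover have "cells_below T b k = cells_below D b k"
    using T(1) dominatedD(1)[OF dom, of b k] by (auto simp: inv_def surplus_def le_less)
  ultimately obtain q where "k < q" "(q, b) \<in> T"
    using cells_below_eq[of k R b T] k_less by fastforce
  moreover have "(q, b) \<notin> T"
    using T(1) \<open>e < b\<close> b_le \<open>\<not> k < s'\<close> \<open>k < s\<close> \<open>k < q\<close>
    by (intro no_cells_right_of_crossing[OF dom T(2)]) (auto simp: inv_def)
  ultimately show False
    by simp
qed

lemma inv_drops:
  assumes T: "inv T" "drops T T' s e s'"
  shows "inv T'"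
proof -
  note d = dropsD[OF T(2)]
  have dom: "dominated T" and packed: "\<And>r. left_packed T r"
    and sur: "\<And>c r. c \<le> b \<Longrightarrow> r \<le> k \<Longrightarrow> \<not> surplus T c r"
    using T(1) by (auto simp: inv_def)
  have "left_packed T' r" for r
  proof (rule left_packed_drops[OF dom T(2) packed])
    fix c
    assume r: "r = s'" and c: "c < e" and "(r, c) \<in> D \<or> surplus T c r"
    have "c < M" "r < R"
      using dominatedD(3,4)[OF dom d(1)] c d(3) r by auto
    from \<open>(r, c) \<in> D \<or> surplus T c r\<close> show "(r, c) \<in> T"
    proof
      \<comment> \<open>\<open>gap\<close> confines this cell of \<open>D\<close> to the block,
        where \<open>T\<close> agrees with \<open>D\<close>.\<close>
      assume D: "(r, c) \<in> D"
      then have "\<not> (if c \<le> b then k else 0) < r"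
        using gap[OF \<open>c < M\<close> _ \<open>r < R\<close>] by blast
      moreover have "0 < r"
        using d(2) r by simp
      ultimately have "c \<le> b" "r \<le> k"
        by (auto split: if_splits)
      with D show ?thesis
        using frozen_mem_iff[OF T(1)] by simp
    next
      \<comment> \<open>Impossible: row \<open>s\<close> is packed and has the moving cell to the
        right of column \<open>c\<close>.\<close>
      assume s: "surplus T c r"
      moreover from this have "(if c \<le> b then k else 0) \<le> r"
        using sur[of c r] by (cases "r \<le> k") auto
      ultimately show ?thesis
        using not_surplus_below_packed[OF dom packed d(1) c, of r] d(3) r by simp
    qed
  qed
  moreover have "\<not> surplus T' c r" if "c \<le> b" "r \<le> k" for c r
    using sur[OF that] not_drops_into_block[OF T] that by (auto simp: surplus_drops[OF dom T(2)])
  ultimately show ?thesis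
    using dominated_drops[OF dom T(2)] by (simp add: inv_def)
qed

lemma inj_on_rwt: "inj_on rwt (kohnert_diagrams D)"
proof -
  have "inv D"
    by (auto simp: inv_def dominated_self left_packed_def)
  then have inv: "inv T" if "T \<in> kohnert_diagrams D" for T
    using kohnert_diagrams_invariant[OF that] inv_drops by blast
  show ?thesis
  proof (rule inj_on_rwtI)
    fix S T r c c'
    assume "S \<in> kohnert_diagrams D" "T \<in> kohnert_diagrams D" and c: "c < c'" "(r, c) \<in> S" "(r, c) \<notin> T"
      "(r, c') \<in> T" and sur: "\<And>q. surplus S q r = surplus T q r"
    then have "inv S" "inv T"
      using inv by auto
    \<comment> \<open>Eligibility depends only on \<open>D\<close> and the surplus, so it passes
      from \<open>S\<close> to \<open>T\<close>.\<close>
    then have "(r, c) \<in> D \<or> surplus T c r"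
      using mem_if_not_surplus[of S r c] c(2) sur by (auto simp: inv_def)
    with \<open>inv T\<close> c show False
      by (auto simp: inv_def left_packed_def)
  qed (use inv in \<open>auto simp: inv_def\<close>)
qed

end

section \<open>A block with a single hole in the last column\<close>

text \<open>
  A cell in a row up to \<open>k\<close> moves only when the hole of the last column is in its row, and that
  hole only moves up.
\<close>

locale single_hole = cleared_rows D R M "\<lambda>_. k"
  for D R M k +
  fixes h :: nat
  assumes h: "1 \<le> h" "h \<le> k" "(h, M) \<notin> D"
    and filled: "1 \<le> r \<Longrightarrow> r \<le> k \<Longrightarrow> r \<noteq> h \<Longrightarrow> (r, M) \<in> D"
    and row_h: "2 \<le> h \<Longrightarrow> c < M \<Longrightarrow> (h, c) \<notin> D"
    and top: "(R, M) \<in> D"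
begin

text \<open>A row up to \<open>k\<close> consists of all its surplus columns and an initial segment
  of the other columns with a cell of \<open>D\<close>, so again the surplus fixes a chain. By the
  third clause, column \<open>M\<close> alone can rule out a surplus anywhere in a row.\<close>

definition inv where
  "inv T \<longleftrightarrow> dominated T \<and> (\<forall>r>k. left_packed T r) \<and>
    (\<forall>c r. r \<le> k \<longrightarrow> surplus T c r \<longrightarrow> surplus T M r) \<and>
    (\<forall>c r. 1 \<le> r \<longrightarrow> r \<le> k \<longrightarrow> surplus T c r \<longrightarrow> (r, c) \<in> T) \<and>
    (\<forall>c c' r. r \<le> k \<longrightarrow> c < c' \<longrightarrow> (r, c) \<in> D \<longrightarrow> (r, c') \<in> D \<longrightarrow>
      \<not> surplus T c r \<longrightarrow> \<not> surplus T c' r \<longrightarrow> (r, c') \<in> T \<longrightarrow> (r, c) \<in> T)"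

lemma invD:
  assumes "inv T"
  shows "dominated T" "\<And>r. k < r \<Longrightarrow> left_packed T r"
    and "\<And>c r. r \<le> k \<Longrightarrow> surplus T c r \<Longrightarrow> surplus T M r"
    and "\<And>c r. 1 \<le> r \<Longrightarrow> r \<le> k \<Longrightarrow> surplus T c r \<Longrightarrow> (r, c) \<in> T"
    and "\<And>c c' r. r \<le> k \<Longrightarrow> c < c' \<Longrightarrow> (r, c) \<in> D \<Longrightarrow> (r, c') \<in> D \<Longrightarrow>
      \<not> surplus T c r \<Longrightarrow> \<not> surplus T c' r \<Longrightarrow> (r, c') \<in> T \<Longrightarrow> (r, c) \<in> T"
  using assms unfolding inv_def by blast+

lemma k_less: "k < R"
  by (rule kappa_less)

lemma cells_below_last: "r \<le> k \<Longrightarrow> cells_below D M r + of_bool (h \<le> r) = r"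
proof (induction r)
  case 0
  then show ?case
    using h(1) by simp
next
  case (Suc r)
  then show ?case
    using h filled[of "Suc r"] by (cases "Suc r = h") (auto simp: of_bool_def split: if_splits)
qed

text \<open>Up to row \<open>r\<close>, column \<open>M\<close> of \<open>D\<close> has at most one
  hole, so one extra cell fills it.\<close>

lemma surplus_last_full:
  assumes "surplus T M r" "r \<le> k"
  shows "cells_below T M r = r"
  using assms cells_below_last[of r] cells_below_le[of T M r]
  by (auto simp: surplus_def of_bool_def split: if_splits)

lemma surplus_last_if_full:
  assumes "cells_below T M t = t" "h \<le> r" "r \<le> t" "r \<le> k"
  shows "surplus T M r"
proof -
  have "cells_below T M r = r"
    using assms(1,3) by (auto simp: cells_below_full_iff)
  then show ?thesis
    using cells_below_last[OF assms(4)] assms(2) by (simp add: surplus_def)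
qed

text \<open>If row \<open>h\<close> met the run above \<open>q\<close>, then by \<open>row_h\<close>
  the cell \<open>(h, c)\<close> would not stem from \<open>D\<close>; column \<open>c\<close> would
  have a surplus at \<open>h\<close> and, along the run, also at \<open>t\<close>.\<close>

lemma hole_le:
  assumes "inv T" "c < M" "1 \<le> q" "h \<le> t" "t \<le> k" "\<not> surplus T c t"
    and col: "\<And>p. q < p \<Longrightarrow> p \<le> t \<Longrightarrow> (p, c) \<in> T"
  shows "h \<le> q"
proof (rule ccontr)
  assume "\<not> h \<le> q"
  then have "2 \<le> h"
    using assms(3) by simp
  then obtain p where p: "h = Suc p"
    by (cases h) auto
  have "(h, c) \<in> T"
    using \<open>\<not> h \<le> q\<close> assms(4) by (intro col) auto
  then have "surplus T c h"
    using row_h[OF \<open>2 \<le> h\<close> assms(2)] p dominatedD(1)[OF invD(1)[OF assms(1)], of c p]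
    by (simp add: surplus_def)
  then have "surplus T c t"
    using assms(4) by (rule surplus_upwards) (use col \<open>\<not> h \<le> q\<close> in auto)
  with assms(6) show False
    by simp
qed

lemma inv_drops:
  assumes T: "inv T" "drops T T' s e s'"
  shows "inv T'"
proof -
  note d = dropsD[OF T(2)]
  note inv = invD[OF T(1)]
  note dom = inv(1)
  note sur_iff = surplus_drops[OF dom T(2)]
  have bounds: "s \<le> R" "e \<le> M"
    using dominatedD(3,4)[OF dom d(1)] by auto
  \<comment> \<open>Up to row \<open>s\<close>, column \<open>M\<close> lacks at most one cell; as
    \<open>(s, e)\<close> is rightmost, it lacks \<open>(s, M)\<close> and hence nothing
    below.\<close>
  have hole: "(s, M) \<notin> T" "h \<le> s" "cells_below T M (s - 1) = s - 1" "\<not> surplus T M s" if "s \<le> k" "e < M"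
  proof -
    show *: "(s, M) \<notin> T"
      using d(5)[of M] that(2) by auto
    obtain p where p: "s = Suc p"
      using d(3) by (cases s) auto
    have "s \<le> cells_below T M s + of_bool (h \<le> s)"
      using cells_below_last[OF that(1)] dominatedD(1)[OF dom, of M s] by linarith
    then show "h \<le> s" "cells_below T M (s - 1) = s - 1" "\<not> surplus T M s"
      using * p cells_below_le[of T M p] cells_below_last[OF that(1)]
      by (auto simp: surplus_def of_bool_def split: if_splits)
  qed
  have not_sur: "\<not> surplus T e s" if "s \<le> k"
  proof (cases "e = M")
    case True
    show ?thesis
    proof
      assume "surplus T e s"
      then have "cells_below T M s = s"
        using surplus_last_full that True by simp
      then show False
        using d(2-4) True by (auto simp: cells_below_full_iff)
    qed
  next
    case False
    then show ?thesis
      using hole(4) inv(3) that bounds(2) by (meson le_neq_implies_less)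
  qed
  \<comment> \<open>This maintains the third clause: where the move creates a surplus in a column
    left of \<open>M\<close>, column \<open>M\<close> already has one.\<close>
  have crossed: "surplus T M r" if "e < M" "s' \<le> r" "r < s" "r \<le> k" for r
  proof (cases "s \<le> k")
    case True
    have "h \<le> s'"
      using hole_le[OF T(1) that(1) d(2) hole(2)[OF True that(1)] True not_sur[OF True] d(6)] .
    then show ?thesis
      using surplus_last_if_full[OF hole(3)[OF True that(1)], of r] that by simp
  next
    case False
    \<comment> \<open>In \<open>D\<close> column \<open>e\<close> has at most one cell above row
      \<open>k\<close>; as \<open>(s, e)\<close> is still above, nothing has crossed row
      \<open>k\<close>.\<close>
    have "cells_below T e k < cells_below T e s"
      using d(1) False by (intro cells_below_less) auto
    also have "\<dots> \<le> cells_below T e R"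
      using bounds(1) by (rule cells_below_mono)
    finally have "\<not> surplus T e k"
      using cells_below_top[OF that(1) dom] by (simp add: surplus_def)
    moreover have "(p, e) \<in> T" if "s' < p" "p \<le> k" for p
      using d(6)[OF that(1)] that(2) False by simp
    ultimately have "h \<le> s'"
      using hole_le[OF T(1) that(1) d(2) h(2) order_refl] by blast
    \<comment> \<open>In contrast, column \<open>M\<close> has no cell left above row
      \<open>k\<close>; its top cell has come down, so it is full up to \<open>k\<close>.\<close>
    have "(q, M) \<notin> T" if "k < q" for q
      using inv(2) \<open>e < M\<close> \<open>s' \<le> r\<close> \<open>r \<le> k\<close> False that
      by (intro no_cells_right_of_crossing[OF dom T(2)]) auto
    then have "cells_below T M R = cells_below T M k"
      using k_less by (intro cells_below_eq) auto
    moreover have "cells_below D M k < cells_below D M R"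
      using top k_less by (rule cells_below_less)
    ultimately have "surplus T M k"
      using dominatedD(2)[OF dom, of M] by (simp add: surplus_def)
    then show ?thesis
      using surplus_last_if_full[OF surplus_last_full, of T k r] \<open>h \<le> s'\<close> that by simp
  qed
  have "left_packed T' r" if r: "k < r" for r
  proof (rule left_packed_drops[OF dom T(2) inv(2)[OF r]])
    fix c
    assume c: "r = s'" "c < e" "(r, c) \<in> D \<or> surplus T c r"
    \<comment> \<open>Between the rows \<open>k\<close> and \<open>R\<close>, no column left of
      \<open>e\<close> is eligible in the landing row.\<close>
    have "(r, c) \<notin> D"
      using gap[of c r] c(1,2) r d(3) bounds by simp
    moreover have "\<not> surplus T c r"
      using not_surplus_below_packed[OF dom inv(2) d(1) c(2), of r] c(1) r d(3) by simp
    ultimately show "(r, c) \<in> T"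
      using c(3) by simp
  qed
  moreover have "surplus T' M r" if "r \<le> k" "surplus T' c r" for c r
    using that inv(3) crossed bounds(2) by (cases "e = M") (auto simp: sur_iff)
  moreover have "(r, c) \<in> T'" if r: "1 \<le> r" "r \<le> k" "surplus T' c r" for c r
  proof (cases "surplus T c r")
    \<comment> \<open>The removed cell is not concerned, since column \<open>e\<close> has no
      surplus at row \<open>s\<close>.\<close>
    case True
    then show ?thesis
      using inv(4)[OF r(1,2)] not_sur r(2) by (auto simp: d(7))
  next
    case False
    then have "c = e" "s' \<le> r" "r < s"
      using r(3) by (auto simp: sur_iff)
    then show ?thesis
      using d(6)[of r] by (cases "r = s'") (auto simp: d(7))
  qed
  moreover have "(r, c) \<in> T'" if r: "r \<le> k" and c: "c < c'" "(r, c) \<in> D" "(r, c') \<in> D"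
    and ns: "\<not> surplus T' c r" "\<not> surplus T' c' r" and c': "(r, c') \<in> T'" for c c' r
  proof -
    have "(r, c') \<noteq> (s', e)"
      using ns(2) d(3) by (auto simp: sur_iff)
    then have "(r, c') \<in> T"
      using c' unfolding d(7) by blast
    moreover from this have "(r, c) \<in> T"
      using inv(5)[OF r c] ns by (simp add: sur_iff)
    ultimately show ?thesis
      using d(5)[of c'] c(1) by (auto simp: d(7))
  qed
  ultimately show ?thesis
    unfolding inv_def using dominated_drops[OF dom T(2)] by blast
qed

lemma inj_on_rwt: "inj_on rwt (kohnert_diagrams D)"
proof -
  have "inv D"
    by (auto simp: inv_def dominated_self left_packed_def)
  then have inv: "inv T" if "T \<in> kohnert_diagrams D" for T
    using kohnert_diagrams_invariant[OF that] inv_drops by blast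
  show ?thesis
  proof (rule inj_on_rwtI)
    fix S T r c c'
    assume P: "S \<in> kohnert_diagrams D" "T \<in> kohnert_diagrams D" and r: "1 \<le> r"
      and c: "c < c'" "(r, c) \<in> S" "(r, c) \<notin> T" "(r, c') \<notin> S" "(r, c') \<in> T"
      and sur: "\<And>q. surplus S q r = surplus T q r"
    note S = invD[OF inv[OF P(1)]] and T = invD[OF inv[OF P(2)]]
    have D: "(r, q) \<in> D" if "(r, q) \<in> S \<or> (r, q) \<in> T" "\<not> surplus T q r" for q
      using that mem_if_not_surplus[OF S(1)] mem_if_not_surplus[OF T(1)] sur by blast
    show False
    proof (cases "r \<le> k")
      case True
      \<comment> \<open>A column with surplus has a cell in row \<open>r\<close> of both diagrams,
        but \<open>S\<close> and \<open>T\<close> differ at \<open>c\<close> and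
        \<open>c'\<close>.\<close>
      have "\<not> surplus T c r" "\<not> surplus T c' r"
        using S(4)[OF r True, of c'] T(4)[OF r True, of c] c sur by auto
      then show ?thesis
        using T(5)[OF True c(1)] D c by blast
    next
      case False
      then have "left_packed T r"
        using T(2) by simp
      then show ?thesis
        using D[of c] c unfolding left_packed_def by blast
    qed
  qed (use invD(1) inv in blast)
qed

end

section \<open>Finding one of the two blocks in a pattern-free diagram\<close>

lemma pattern_free_imp_inj_on_rwt:
  assumes D: "diagram D" "northeast D"
    and free: "\<not> (\<exists>r1 c1 r2 c2. (r1, c1) \<in> D \<and> (r2, c2) \<in> D \<and> r1 < r2 \<and> c1 < c2 \<and>
        (\<exists>r<r1. empty_position D (r, c1)) \<and>
        (\<forall>c>c1. card {r. r \<le> r1 \<and> empty_position D (r, c)} \<ge> 2))"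
  shows "inj_on rwt (kohnert_diagrams D)"
proof (cases "D = {}")
  case True
  have "T = {}" if "kohnert_move\<^sup>*\<^sup>* {} T" for T
    using that by (induction) (auto simp: kohnert_move_def rightmost_in_row_def)
  then show ?thesis
    using True by (auto simp: kohnert_diagrams_def inj_on_def)
next
  case False
  have fin: "finite D" and pos: "\<And>r c. (r, c) \<in> D \<Longrightarrow> 1 \<le> r \<and> 1 \<le> c"
    using D(1) by (auto simp: diagram_def positions_def)
  have ne: "(max r1 r2, max c1 c2) \<in> D" if "(r1, c1) \<in> D" "(r2, c2) \<in> D" for r1 c1 r2 c2
    using D(2) that by (auto simp: northeast_def)
  define R M where "R = Max (fst ` D)" and "M = Max (snd ` D)"
  have le: "r \<le> R" "c \<le> M" if "(r, c) \<in> D" for r c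
    using fin that unfolding R_def M_def by (auto intro!: Max_ge rev_image_eqI)
  obtain c r where "(R, c) \<in> D" "(r, M) \<in> D"
    using Max_in[of "fst ` D"] Max_in[of "snd ` D"] fin False unfolding R_def M_def by fastforce
  then have top: "(R, M) \<in> D"
    using ne[of R c r M] le by (metis max.absorb1 max.absorb2)
  have sub: "D \<subseteq> {1..R} \<times> {1..M}"
    using le pos by auto
  have "1 \<le> R"
    using pos[OF top] by simp
  define K where "K = {r. r < R \<and> (\<exists>c<M. (r, c) \<in> D)}"
  \<comment> \<open>The default 0 gives an empty block; it falls under the case of a full last
    column below.\<close>
  define k where "k = (if K = {} then 0 else Max K)"
  have finK: "finite K"
    by (rule finite_subset[of _ "{..R}"]) (auto simp: K_def)
  have "k < R"
    using Max_in[OF finK] \<open>1 \<le> R\<close> by (auto simp: k_def K_def)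
  have gap: "(r, c) \<notin> D" if "c < M" "k < r" "r < R" for r c
  proof
    assume "(r, c) \<in> D"
    then have "r \<in> K"
      using that by (auto simp: K_def)
    then have "r \<le> k"
      using finK by (auto simp: k_def)
    with that show False
      by simp
  qed
  show ?thesis
  proof (cases "\<exists>g h. g \<noteq> h \<and> {g, h} \<subseteq> {1..k} \<and> (g, M) \<notin> D \<and> (h, M) \<notin> D")
    case True
    then obtain g h where gh: "g \<noteq> h" "g \<in> {1..k}" "h \<in> {1..k}" "(g, M) \<notin> D" "(h, M) \<notin> D"
      by blast
    then have "K \<noteq> {}"
      by (auto simp: k_def)
    then have "k \<in> K"
      using Max_in[OF finK] by (simp add: k_def)
    define b where "b = Max {c. c < M \<and> (k, c) \<in> D}"
    have "b \<in> {c. c < M \<and> (k, c) \<in> D}"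
      unfolding b_def using \<open>k \<in> K\<close> by (intro Max_in) (auto simp: K_def)
    then have b: "b < M" "(k, b) \<in> D"
      by auto
    have le_b: "c \<le> b" if "c < M" "(k, c) \<in> D" for c
      unfolding b_def using that by (intro Max_ge) auto
    \<comment> \<open>A cell here would force \<open>(k, c)\<close> by the northeast condition,
      against the choice of \<open>b\<close>.\<close>
    have right: "(r, c) \<notin> D" if "b < c" "c < M" "r \<le> k" for r c
      using ne[OF b(2), of r c] that le_b[of c] by (auto simp: max_def)
    have full: "(r, b) \<in> D" if "1 \<le> r" "r \<le> k" for r
    proof (rule ccontr)
      assume "(r, b) \<notin> D"
      moreover from this have "r < k"
        using b(2) that by (cases "r = k") auto
      ultimately have "\<exists>r<k. empty_position D (r, b)"
        using that pos[OF b(2)] by (auto simp: empty_position_def positions_def)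
      \<comment> \<open>The cells \<open>(k, b)\<close> and \<open>(R, M)\<close> satisfy all but
        the last condition of the pattern, so some column \<open>c\<close> has fewer than two holes.
        But column \<open>M\<close> has the holes \<open>g\<close> and \<open>h\<close>, and any
        other column right of \<open>b\<close> is empty up to row \<open>k\<close>.\<close>
      then obtain c where c: "b < c" "\<not> 2 \<le> card {r. r \<le> k \<and> empty_position D (r, c)}"
        using free b top \<open>k < R\<close> by blast
      have "1 \<le> c"
        using c(1) by simp
      have "\<exists>g h. g \<noteq> h \<and> g \<in> {1..k} \<and> h \<in> {1..k} \<and> (g, c) \<notin> D \<and> (h, c) \<notin> D"
      proof (cases "c = M")
        case True
        then show ?thesis
          using gh by blast
      next
        case False
        then have "(g, c) \<notin> D" "(h, c) \<notin> D"
          using right[OF c(1)] le gh(2,3) by (metis atLeastAtMost_iff le_neq_implies_less)+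
        then show ?thesis
          using gh by blast
      qed
      then obtain g' h' where "g' \<noteq> h'"
        and sub2: "{g', h'} \<subseteq> {r. r \<le> k \<and> empty_position D (r, c)}"
        using \<open>1 \<le> c\<close> by (auto simp: empty_position_def positions_def)
      then have "card {g', h'} = 2"
        by simp
      moreover have "card {g', h'} \<le> card {r. r \<le> k \<and> empty_position D (r, c)}"
        using sub2 by (rule card_mono[rotated]) simp
      ultimately show False
        using c(2) by simp
    qed
    interpret frozen_block D R M b k
    proof
      show "(r, c) \<notin> D" if "c < M" "(if c \<le> b then k else 0) < r" "r < R" for r c
      proof (cases "k < r")
        case False
        then have "b < c"
          using that(2) by (auto split: if_splits)
        with False show ?thesis
          using right that(1) by simp
      qed (use gap that in blast)
      show "(R, b) \<in> D" if "c < b" "(R, c) \<in> D" for c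
        using ne[OF b(2) that(2)] that(1) \<open>k < R\<close> by (simp add: max_def)
    qed (use sub b full \<open>k < R\<close> \<open>1 \<le> R\<close> in auto)
    show ?thesis
      by (rule inj_on_rwt)
  next
    case False
    show ?thesis
    proof (cases "\<forall>r\<in>{1..k}. (r, M) \<in> D")
      \<comment> \<open>Column \<open>M\<close> itself serves as the full column.\<close>
      case True
      interpret frozen_block D R M M k
        by unfold_locales (use sub gap top True \<open>k < R\<close> in auto)
      show ?thesis
        by (rule inj_on_rwt)
    next
      case hole: False
      then obtain h where h: "1 \<le> h" "h \<le> k" "(h, M) \<notin> D"
        by auto
      then have filled: "(r, M) \<in> D" if "1 \<le> r" "r \<le> k" "r \<noteq> h" for r
        using False that by auto
      \<comment> \<open>For \<open>2 \<le> h\<close> the cell \<open>(1, M)\<close> is present, and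
        together with \<open>(h, c)\<close> it would force \<open>(h, M)\<close>.\<close>
      have "(h, c) \<notin> D" if "2 \<le> h" "c < M" for c
        using ne[OF _ filled[of 1], of h c] that h by (auto simp: max_def split: if_splits)
      then interpret single_hole D R M k h
        by unfold_locales (use sub gap top h filled \<open>k < R\<close> in auto)
      show ?thesis
        by (rule inj_on_rwt)
    qed
  qed
qed

theorem theorem1p3:
  fixes D0 :: "(nat \<times> nat) set"
  assumes "diagram D0"
    and "northeast D0"
  shows "monomial_multiplicity_free (kohnert_polynomial D0) \<longleftrightarrow>
    \<not> (\<exists>r1 c1 r2 c2. (r1, c1) \<in> D0 \<and> (r2, c2) \<in> D0 \<and>
        r1 < r2 \<and>
        c1 < c2 \<and>
        (\<exists>r<r1. empty_position D0 (r, c1)) \<and>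
        (\<forall>c>c1. card {r. r \<le> r1 \<and> empty_position D0 (r, c)} \<ge> 2))"
  unfolding multiplicity_free_iff_inj_on_rwt[OF assms(1)]
  using pattern_imp_not_inj_on_rwt[OF assms] pattern_free_imp_inj_on_rwt[OF assms] by blast

end
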